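(* There is an absolute constant $c>0$ such that for each integer $N\ge 1$ there is a sequence $a_n\in\mathbb{C}$, $-N\le n\le N$, not identically zero, such that $$\Big\|\sum_{n=-N}^N a_n\,e\big(nx+n^2y-n^3(y+x^3)^3\big)\Big\|_{L^6([-1,1]^2)}\ge c\,N^{1/36}\Big(\sum_{n=-N}^N|a_n|^2\Big)^{1/2}.$$
   Context: $e(z)=e^{2\pi i z}$. The $L^6([-1,1]^2)$ norm is taken in the real variables $(x,y)$. *)

theory Defs
  imports "HOL-Analysis.Analysis"
begin

definition e_char :: "complex \<Rightarrow> complex" where
  "e_char z = exp (2 * of_real pi * \<i> * z)"

text \<open>
  The Bochner integral is \<open>0\<close> on non-integrable functions, so this is the norm only for
  \<open>f\<close> in \<open>L\<^sup>p(A)\<close>; in particular it is the norm for \<open>f\<close> continuous on a compact set \<open>A\<close>.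
\<close>
definition Lp_norm_on ::
    "real \<Rightarrow> 'a::euclidean_space set \<Rightarrow> ('a \<Rightarrow> 'b::real_normed_vector) \<Rightarrow> real" where
  "Lp_norm_on p A f = (LINT z:A|lborel. norm (f z) powr p) powr (1 / p)"

definition exp_sum :: "nat \<Rightarrow> (int \<Rightarrow> complex) \<Rightarrow> real \<times> real \<Rightarrow> complex" where
  "exp_sum N a = (\<lambda>(x, y). \<Sum>n = - int N..int N.
     a n * e_char (of_real (of_int n * x + of_int n ^ 2 * y - of_int n ^ 3 * (y + x ^ 3) ^ 3)))"

end

theory Submission
  imports Defs
begin

text \<open>
  Write \<open>n = N - m\<close> and \<open>t = y + x\<^sup>3\<close>. The coefficient of \<open>m\<close> in the phase is
  \<open>- (x - 2 N x\<^sup>3 + 2 N t - 3 N\<^sup>2 t\<^sup>3)\<close>; it has a critical point at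
  \<open>6 N x\<^sup>2 = 1\<close>, \<open>9 N t\<^sup>2 = 2\<close>. Near that point, on a rectangle whose sides are small
  multiples of \<open>N powr (- 2/3)\<close> in \<open>x\<close> and \<open>N powr (- 5/3)\<close> in \<open>y\<close>, the coefficients of
  \<open>m\<close>, \<open>m\<^sup>2\<close>, \<open>m\<^sup>3\<close> vary by so little that for \<open>m\<close> up to a small multiple \<open>K\<close> of
  \<open>N powr (5/6)\<close> all terms can be aligned by unimodular \<open>a\<^sub>n\<close>. The sixth power of the norm is
  then \<open>\<ge> c K\<^sup>6 N powr (- 7/3)\<close>, which is \<open>c N powr (1/6)\<close> times \<open>K\<^sup>3\<close>.
  All these powers of \<open>N\<close> become polynomial in \<open>s = root 6 N\<close> and \<open>r = 1 / s\<close>.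
\<close>

section \<open>Lower bounds for an L^p norm\<close>

text \<open>A Chebyshev-type bound. Continuity on the compact set \<open>A\<close> gives
  integrability, so the Bochner integral does not fall back to its default value 0.\<close>

lemma Lp_norm_on_lower_bound:
  fixes f :: "'a::euclidean_space \<Rightarrow> 'b::real_normed_vector"
  assumes "p > 0" "compact A" "continuous_on A f" "B \<in> sets borel" "B \<subseteq> A" "k \<ge> 0"
    and f_ge: "\<And>z. z \<in> B \<Longrightarrow> norm (f z) \<ge> k"
  shows "k * measure lborel B powr (1 / p) \<le> Lp_norm_on p A f"
proof -
  have "continuous_on A (\<lambda>z. norm (f z) powr p)"
    using assms by (intro continuous_on_powr' continuous_intros) auto
  then have intA: "set_integrable lborel A (\<lambda>z. norm (f z) powr p)"
    unfolding set_integrable_def using borel_integrable_compact \<open>compact A\<close> by blast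
  have intB: "set_integrable lborel B (\<lambda>z. norm (f z) powr p)"
    by (rule set_integrable_subset[OF intA]) (use assms in auto)
  have "emeasure lborel B < \<infinity>"
    by (meson \<open>B \<subseteq> A\<close> \<open>compact A\<close> bounded_subset compact_imp_bounded emeasure_bounded_finite)
  then have intk: "set_integrable lborel B (\<lambda>z. k powr p)"
    unfolding set_integrable_def using \<open>B \<in> sets borel\<close> by simp
  have "measure lborel B * k powr p = (LINT z:B|lborel. k powr p)"
    using \<open>B \<in> sets borel\<close> \<open>emeasure lborel B < \<infinity>\<close>
    unfolding set_lebesgue_integral_def by simp
  also have "\<dots> \<le> (LINT z:B|lborel. norm (f z) powr p)"
    by (rule set_integral_mono[OF intk intB]) (use assms in \<open>auto intro: powr_mono2\<close>)
  also have "\<dots> \<le> (LINT z:A|lborel. norm (f z) powr p)"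
    unfolding set_lebesgue_integral_def
    by (rule integral_mono)
      (use intA intB \<open>B \<subseteq> A\<close> in \<open>auto simp: set_integrable_def indicator_def\<close>)
  finally have "(measure lborel B * k powr p) powr (1 / p) \<le> Lp_norm_on p A f"
    unfolding Lp_norm_on_def using \<open>p > 0\<close> by (intro powr_mono2) auto
  then show ?thesis
    using assms by (simp add: powr_mult powr_powr mult.commute)
qed

section \<open>Variation of the phase near the critical point\<close>

definition phase :: "real \<Rightarrow> real \<Rightarrow> real \<Rightarrow> real" where
  "phase n x y = n * x + n ^ 2 * y - n ^ 3 * (y + x ^ 3) ^ 3"

text \<open>The coordinate \<open>t\<close> splits the coefficient of \<open>m\<close> into a
  function of \<open>x\<close> plus a function of \<open>t\<close>, so each can be made stationary
  separately.\<close>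

lemma phase_taylor:
  "phase (N - m) x (t - x ^ 3) - phase N x (t - x ^ 3) =
     - m * (x - 2 * N * x ^ 3 + 2 * N * t - 3 * N ^ 2 * t ^ 3)
     + m ^ 2 * (t - x ^ 3 - 3 * N * t ^ 3) + m ^ 3 * t ^ 3"
  unfolding phase_def by algebra

text \<open>
  The base point is \<open>x\<^sub>0 = p r\<^sup>3 = 1 / sqrt (6 N)\<close>, \<open>t\<^sub>0 = q r\<^sup>3 = sqrt (2 / (9 N))\<close>,
  and \<open>T\<close> is the displacement of \<open>t\<close> in units of \<open>r\<^sup>1\<^sup>0\<close>.
\<close>

lemma phase_drift_rescaled:
  fixes p q r s \<mu> X Y T :: real
  assumes "r * s = 1" and p2: "6 * p ^ 2 = 1" and q2: "9 * q ^ 2 = 2"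
    and T: "T = Y + 3 * p ^ 2 * X + 3 * p * X ^ 2 * r + X ^ 3 * r ^ 2"
  defines "D \<equiv> \<lambda>n. phase n (p * r ^ 3 + X * r ^ 4) (q * r ^ 3 - p ^ 3 * r ^ 9 + Y * r ^ 10)
                     - phase n (p * r ^ 3) (q * r ^ 3 - p ^ 3 * r ^ 9)"
  shows "D (s ^ 6 - \<mu> * s ^ 5) - D (s ^ 6) =
     \<mu> * (6 * p * X ^ 2 + 2 * X ^ 3 * r + 9 * q * T ^ 2 * r ^ 6 + 3 * T ^ 3 * r ^ 13)
     + \<mu> ^ 2 * (Y - 2 * T - 9 * q * T ^ 2 * r ^ 7 - 3 * T ^ 3 * r ^ 14)
     + \<mu> ^ 3 * (3 * q ^ 2 * T * r + 3 * q * T ^ 2 * r ^ 8 + T ^ 3 * r ^ 15)"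
proof -
  define x0 x1 t0 t1 where "x0 = p * r ^ 3" "x1 = p * r ^ 3 + X * r ^ 4"
    and "t0 = q * r ^ 3" "t1 = q * r ^ 3 + T * r ^ 10"
  note defs = this
  have y0: "q * r ^ 3 - p ^ 3 * r ^ 9 = t0 - x0 ^ 3"
    unfolding defs by algebra
  \<comment> \<open>The increment of \<open>x ^ 3\<close> is of order \<open>x0 ^ 2 * r ^ 4\<close>,
    which is the scale \<open>r ^ 10\<close> of the increment of \<open>y\<close>; adding the two
    gives \<open>T\<close>.\<close>
  have y1: "q * r ^ 3 - p ^ 3 * r ^ 9 + Y * r ^ 10 = t1 - x1 ^ 3"
    unfolding defs T by algebra
  define m N where "m = \<mu> * s ^ 5" "N = s ^ 6"
  note mN = this
  have rs: "r ^ k * s ^ k = 1" for k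
    using \<open>r * s = 1\<close> by (metis power_mult_distrib power_one)
  have Nr: "N * r ^ 6 = 1" using rs[of 6] mN by (simp add: mult.commute)
  \<comment> \<open>The term linear in \<open>X\<close> has the factor
    \<open>1 - 6 * N * x0 ^ 2\<close>, which vanishes by \<open>p2\<close>. In \<open>Dt\<close> the
    factor \<open>2 * N - 9 * N ^ 2 * t0 ^ 2\<close> vanishes by \<open>q2\<close>.\<close>
  have Dx: "(x1 - 2 * N * x1 ^ 3) - (x0 - 2 * N * x0 ^ 3)
      = - (r ^ 5) * (6 * p * X ^ 2 + 2 * X ^ 3 * r)"
    using Nr p2 unfolding defs by algebra
  have Dt: "(2 * N * t1 - 3 * N ^ 2 * t1 ^ 3) - (2 * N * t0 - 3 * N ^ 2 * t0 ^ 3)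
      = - (r ^ 5) * (9 * q * T ^ 2 * r ^ 6 + 3 * T ^ 3 * r ^ 13)"
    using Nr q2 unfolding defs by algebra
  \<comment> \<open>Linear terms survive here, but their scale \<open>r ^ 10\<close> exactly
    balances \<open>m ^ 2 = \<mu> ^ 2 * s ^ 10\<close>.\<close>
  have Dv: "(t1 - x1 ^ 3 - 3 * N * t1 ^ 3) - (t0 - x0 ^ 3 - 3 * N * t0 ^ 3)
      = r ^ 10 * (Y - 2 * T - 9 * q * T ^ 2 * r ^ 7 - 3 * T ^ 3 * r ^ 14)"
  proof -
    have "3 * N * t1 ^ 3 - 3 * N * t0 ^ 3
        = r ^ 10 * (2 * T + 9 * q * T ^ 2 * r ^ 7 + 3 * T ^ 3 * r ^ 14)"
      using Nr q2 unfolding defs by algebra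
    moreover have "(t1 - x1 ^ 3) - (t0 - x0 ^ 3) = r ^ 10 * Y"
      using y0 y1 by algebra
    ultimately show ?thesis by algebra
  qed
  have Dw: "t1 ^ 3 - t0 ^ 3 = r ^ 15 * (3 * q ^ 2 * T * r + 3 * q * T ^ 2 * r ^ 8 + T ^ 3 * r ^ 15)"
    unfolding defs by algebra
  have "D (N - m) - D N =
      - m * (((x1 - 2 * N * x1 ^ 3) - (x0 - 2 * N * x0 ^ 3))
        + ((2 * N * t1 - 3 * N ^ 2 * t1 ^ 3) - (2 * N * t0 - 3 * N ^ 2 * t0 ^ 3)))
      + m ^ 2 * ((t1 - x1 ^ 3 - 3 * N * t1 ^ 3) - (t0 - x0 ^ 3 - 3 * N * t0 ^ 3))
      + m ^ 3 * (t1 ^ 3 - t0 ^ 3)"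
    using phase_taylor[of N m x1 t1] phase_taylor[of N m x0 t0]
    unfolding D_def y1 unfolding y0 unfolding defs(2)[symmetric] unfolding defs(1)[symmetric]
    by algebra
  also have "\<dots> = (m * r ^ 5) * (6 * p * X ^ 2 + 2 * X ^ 3 * r + 9 * q * T ^ 2 * r ^ 6 + 3 * T ^ 3 * r ^ 13)
     + (m * r ^ 5) ^ 2 * (Y - 2 * T - 9 * q * T ^ 2 * r ^ 7 - 3 * T ^ 3 * r ^ 14)
     + (m * r ^ 5) ^ 3 * (3 * q ^ 2 * T * r + 3 * q * T ^ 2 * r ^ 8 + T ^ 3 * r ^ 15)"
    unfolding Dx Dt Dv Dw by algebra
  also have "m * r ^ 5 = \<mu>"
    using rs[of 5] mN by (simp add: mult.assoc mult.commute)
  finally show ?thesis unfolding mN .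
qed

text \<open>Interval arithmetic: chained after \<open>order_trans\<close>, these rules compute a
  bound for a polynomial from bounds on its atoms and leave only a comparison of numerals.\<close>

lemma abs_bounds:
  fixes a b A B :: real
  assumes "\<bar>a\<bar> \<le> A"
  shows "\<bar>b\<bar> \<le> B \<Longrightarrow> \<bar>a + b\<bar> \<le> A + B" "\<bar>b\<bar> \<le> B \<Longrightarrow> \<bar>a - b\<bar> \<le> A + B"
    "\<bar>b\<bar> \<le> B \<Longrightarrow> \<bar>a * b\<bar> \<le> A * B" "\<bar>a ^ k\<bar> \<le> A ^ k"
  using assms by (auto simp: abs_mult mult_mono' power_abs power_mono)

text \<open>After rescaling, only nonnegative powers of \<open>r\<close> remain, and
  \<open>r \<le> 1\<close> makes the bound uniform in \<open>s\<close>. Subtracting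
  \<open>D (s ^ 6)\<close> removes the phase common to all frequencies.\<close>

lemma phase_drift_le:
  fixes p q r s \<mu> X Y :: real
  assumes rs: "r * s = 1" and r: "0 < r" "r \<le> 1"
    and p: "0 \<le> p" "6 * p ^ 2 = 1" and q: "0 \<le> q" "9 * q ^ 2 = 2"
    and \<mu>: "\<bar>\<mu>\<bar> \<le> 1 / 10" and X: "\<bar>X\<bar> \<le> 1 / 10" and Y: "\<bar>Y\<bar> \<le> 1 / 10"
  defines "D \<equiv> \<lambda>n. phase n (p * r ^ 3 + X * r ^ 4) (q * r ^ 3 - p ^ 3 * r ^ 9 + Y * r ^ 10)
                     - phase n (p * r ^ 3) (q * r ^ 3 - p ^ 3 * r ^ 9)"
  shows "\<bar>D (s ^ 6 - \<mu> * s ^ 5) - D (s ^ 6)\<bar> \<le> 1 / 6"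
proof -
  define T where "T = Y + 3 * p ^ 2 * X + 3 * p * X ^ 2 * r + X ^ 3 * r ^ 2"
  have "p ^ 2 \<le> (1 / 2) ^ 2" "q ^ 2 \<le> (1 / 2) ^ 2"
    using p q by (simp_all add: power2_eq_square)
  then have p_le: "\<bar>p\<bar> \<le> 1 / 2" and q_le: "\<bar>q\<bar> \<le> 1 / 2"
    by (simp_all add: abs_le_square_iff[symmetric])
  have r_le: "\<bar>r\<bar> \<le> 1" using r by simp
  have num: "\<bar>numeral k :: real\<bar> \<le> numeral k" for k by simp
  have T: "\<bar>T\<bar> \<le> 1 / 5"
    unfolding T_def
    by (rule order_trans, (rule abs_bounds num p_le r_le X Y)+) (simp add: power_divide)
  show ?thesis
    unfolding D_def phase_drift_rescaled[OF rs p(2) q(2) T_def]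
    by (rule order_trans, (rule abs_bounds num p_le q_le r_le \<mu> X Y T)+) (simp add: power_divide)
qed

section \<open>Sums of nearly aligned exponentials\<close>

text \<open>Rotating by \<open>- \<beta>\<close> brings every argument within \<open>pi / 3\<close>
  of 0, where the cosine is at least 1/2; hence the tolerance 1/6.\<close>

lemma norm_sum_e_char_ge:
  assumes "\<And>n. n \<in> A \<Longrightarrow> \<bar>\<theta> n - \<beta>\<bar> \<le> 1 / 6"
  shows "real (card A) / 2 \<le> cmod (\<Sum>n\<in>A. e_char (of_real (\<theta> n)))"
proof -
  have e_char_cis: "e_char (of_real x) = cis (2 * pi * x)" for x
    by (simp add: e_char_def cis_conv_exp mult.commute mult.left_commute)
  have half: "1 / 2 \<le> cos (2 * pi * (\<theta> n - \<beta>))" if "n \<in> A" for n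
  proof -
    have "\<bar>2 * pi * (\<theta> n - \<beta>)\<bar> \<le> pi / 3"
      using assms[OF that] by (simp add: abs_mult)
    then have "cos (pi / 3) \<le> cos \<bar>2 * pi * (\<theta> n - \<beta>)\<bar>"
      using pi_gt_zero by (intro cos_monotone_0_pi_le) auto
    then show ?thesis by (simp add: cos_60)
  qed
  have "real (card A) / 2 = (\<Sum>n\<in>A. 1 / 2)"
    by simp
  also have "\<dots> \<le> (\<Sum>n\<in>A. cos (2 * pi * (\<theta> n - \<beta>)))"
    by (rule sum_mono) (rule half)
  also have "\<dots> = Re (cis (- (2 * pi * \<beta>)) * (\<Sum>n\<in>A. e_char (of_real (\<theta> n))))"
    by (simp add: sum_distrib_left e_char_cis cis_mult algebra_simps)
  also have "\<dots> \<le> cmod (cis (- (2 * pi * \<beta>)) * (\<Sum>n\<in>A. e_char (of_real (\<theta> n))))"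
    by (rule complex_Re_le_cmod)
  finally show ?thesis by (simp add: norm_mult)
qed

lemma continuous_on_exp_sum: "continuous_on S (exp_sum N a)"
  unfolding exp_sum_def e_char_def case_prod_unfold by (intro continuous_intros)

section \<open>The extremal coefficients and the final count of powers\<close>

theorem theorem4p6:
  shows "\<exists>c::real. c > 0 \<and> (\<forall>N::nat. N \<ge> 1 \<longrightarrow>
    (\<exists>a :: int \<Rightarrow> complex.
      (\<exists>n \<in> {- int N..int N}. a n \<noteq> 0) \<and>
      Lp_norm_on 6 ({-1..1} \<times> {-1..1}) (exp_sum N a)
        \<ge> c * real N powr (1 / 36) * sqrt (\<Sum>n = - int N..int N. (cmod (a n))\<^sup>2)))"
proof (intro exI[of _ "1 / 20"] conjI allI impI)
  fix N :: nat
  assume "N \<ge> 1"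
  define s where "s = root 6 (real N)"
  define r where "r = 1 / s"
  have s6: "s ^ 6 = real N" unfolding s_def by (simp add: real_root_pow_pos2)
  have s1: "1 \<le> s" unfolding s_def using \<open>N \<ge> 1\<close> by simp
  have rs: "r * s = 1" and r: "0 < r" "r \<le> 1" unfolding r_def using s1 by auto
  have rsk: "r ^ k * s ^ k = 1" "s ^ k * r ^ k = 1" for k
    using rs by (metis power_mult_distrib power_one mult.commute)+
  define p q :: real where "p = sqrt (1 / 6)" "q = sqrt (2 / 9)"
  then have p: "0 \<le> p" "6 * p ^ 2 = 1" and q: "0 \<le> q" "9 * q ^ 2 = 2" by simp_all
  have "p ^ 2 \<le> (1 / 2) ^ 2" "q ^ 2 \<le> (1 / 2) ^ 2"
    using p q by (simp_all add: power2_eq_square)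
  then have p_le: "p \<le> 1 / 2" and q_le: "q \<le> 1 / 2"
    by (auto dest: power2_le_imp_le)
  define x0 y0 where "x0 = p * r ^ 3" "y0 = q * r ^ 3 - p ^ 3 * r ^ 9"
  note xy0 = this
  \<comment> \<open>For \<open>N - n \<le> s ^ 5 / 10\<close> the rescaled variable
    \<open>\<mu>\<close> is at most 1/10.\<close>
  define M where "M = nat \<lfloor>s ^ 5 / 10\<rfloor>"
  define I where "I = {int N - int M..int N}"
  \<comment> \<open>These coefficients cancel the phases at the base point, leaving the phase
    differences \<open>D n\<close> at other points.\<close>
  define a where "a n = (if n \<in> I then e_char (of_real (- phase (of_int n) x0 y0)) else 0)" for n
  define B where "B = cbox (x0 - r ^ 4 / 10, y0 - r ^ 10 / 10) (x0 + r ^ 4 / 10, y0 + r ^ 10 / 10)"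
  define K where "K = real (card I)"
  have MK: "real M \<le> s ^ 5 / 10" and K_ge: "s ^ 5 / 10 \<le> K"
  proof -
    have "0 \<le> s ^ 5 / 10" using s1 by simp
    then show "real M \<le> s ^ 5 / 10" unfolding M_def by (rule of_nat_floor)
    \<comment> \<open>The extra 1 absorbs the rounding, also when \<open>M = 0\<close> for small
      \<open>N\<close>.\<close>
    have "K = real M + 1" unfolding K_def I_def by simp
    moreover have "s ^ 5 / 10 \<le> real M + 1" unfolding M_def by linarith
    ultimately show "s ^ 5 / 10 \<le> K" by simp
  qed
  have "0 \<le> s ^ 5" "s ^ 5 \<le> s ^ 6"
    using s1 by (auto intro: power_increasing)
  then have "M \<le> N" using MK s6 by linarith
  then have I_sub: "I \<subseteq> {- int N..int N}" unfolding I_def by auto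
  have norm_a: "cmod (a n) = (if n \<in> I then 1 else 0)" for n
    by (simp add: a_def e_char_def)
  show "\<exists>a. (\<exists>n\<in>{- int N..int N}. a n \<noteq> 0) \<and>
      1 / 20 * real N powr (1 / 36) * sqrt (\<Sum>n = - int N..int N. (cmod (a n))\<^sup>2)
      \<le> Lp_norm_on 6 ({-1..1} \<times> {-1..1}) (exp_sum N a)"
  proof (intro exI[of _ a] conjI)
    have "int N \<in> I" unfolding I_def by simp
    then show "\<exists>n\<in>{- int N..int N}. a n \<noteq> 0"
      using norm_a[of "int N"] I_sub by (metis norm_zero subsetD zero_neq_one)
    have "(\<Sum>n = - int N..int N. (cmod (a n))\<^sup>2) = (\<Sum>n\<in>I. 1)"
      by (rule sum.mono_neutral_cong_right) (use I_sub norm_a in auto)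
    then have l2: "(\<Sum>n = - int N..int N. (cmod (a n))\<^sup>2) = K"
      by (simp add: K_def)
    have big: "K / 2 \<le> cmod (exp_sum N a z)" if "z \<in> B" for z
    proof -
      obtain x y where z: "z = (x, y)" by fastforce
      define X Y where "X = (x - x0) * s ^ 4" "Y = (y - y0) * s ^ 10"
      note XY = this
      have "X * r ^ 4 = x - x0" "Y * r ^ 10 = y - y0"
        unfolding XY by (simp_all add: mult.assoc rsk)
      then have x: "x = p * r ^ 3 + X * r ^ 4" and y: "y = q * r ^ 3 - p ^ 3 * r ^ 9 + Y * r ^ 10"
        unfolding xy0 by simp_all
      have "x0 - r ^ 4 / 10 \<le> x" "x \<le> x0 + r ^ 4 / 10"
        "y0 - r ^ 10 / 10 \<le> y" "y \<le> y0 + r ^ 10 / 10"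
        using that unfolding B_def z cbox_Pair_eq by auto
      then have "\<bar>x - x0\<bar> \<le> r ^ 4 / 10" "\<bar>y - y0\<bar> \<le> r ^ 10 / 10"
        by linarith+
      then have "\<bar>X * r ^ 4\<bar> \<le> r ^ 4 / 10" "\<bar>Y * r ^ 10\<bar> \<le> r ^ 10 / 10"
        using x y unfolding xy0 by simp_all
      then have X: "\<bar>X\<bar> \<le> 1 / 10" and Y: "\<bar>Y\<bar> \<le> 1 / 10"
        using r by (simp_all add: abs_mult)
      define D where "D n = phase n x y - phase n x0 y0" for n
      have "\<bar>D (of_int n) - D (real N)\<bar> \<le> 1 / 6" if "n \<in> I" for n
      proof -
        define \<mu> where "\<mu> = (real N - of_int n) * r ^ 5"
        have "0 \<le> real N - of_int n" "real N - of_int n \<le> s ^ 5 / 10"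
          using that MK unfolding I_def by auto
        then have "\<bar>\<mu>\<bar> \<le> s ^ 5 / 10 * r ^ 5"
          using r unfolding \<mu>_def by (simp add: abs_mult mult_right_mono)
        then have \<mu>: "\<bar>\<mu>\<bar> \<le> 1 / 10"
          by (simp add: rsk)
        have n: "of_int n = s ^ 6 - \<mu> * s ^ 5"
          unfolding \<mu>_def s6 by (simp add: mult.assoc rsk)
        show ?thesis
          using phase_drift_le[OF rs r p q \<mu> X Y]
          unfolding D_def n s6[symmetric] x y xy0 by simp
      qed
      from norm_sum_e_char_ge[where \<theta> = "\<lambda>n. D (of_int n)", OF this]
      have "K / 2 \<le> cmod (\<Sum>n\<in>I. e_char (of_real (D (of_int n))))"
        unfolding K_def .
      also have "(\<Sum>n\<in>I. e_char (of_real (D (of_int n)))) = exp_sum N a z"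
        unfolding exp_sum_def z prod.case
        by (rule sum.mono_neutral_cong_left)
          (use I_sub in \<open>auto simp: a_def D_def phase_def e_char_def exp_add[symmetric] algebra_simps\<close>)
      finally show ?thesis .
    qed
    \<comment> \<open>The centre coordinates are at most 1/2 in absolute value and the half-sides at
      most 1/10, even for \<open>N = 1\<close>.\<close>
    have "B \<subseteq> {-1..1} \<times> {-1..1}"
    proof -
      have rk: "0 \<le> r ^ k" "r ^ k \<le> 1" for k
        using r by (simp_all add: power_le_one)
      have mult: "0 \<le> b * r ^ k \<and> b * r ^ k \<le> 1 / 2" if "0 \<le> b" "b \<le> 1 / 2" for b k
        using mult_mono[of b "1 / 2" "r ^ k" 1] that rk[of k] by simp
      have "p ^ 3 \<le> (1 / 2) ^ 3" using power_mono[OF p_le p(1)] .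
      then have "0 \<le> p ^ 3" "p ^ 3 \<le> 1 / 2" using p by (simp_all add: power_divide)
      note mult[OF p(1) p_le, of 3] mult[OF q(1) q_le, of 3] mult[OF this, of 9]
      then show ?thesis
        using rk[of 4] rk[of 10] unfolding B_def xy0 by (auto simp: cbox_Pair_eq)
    qed
    then have lower: "K / 2 * measure lborel B powr (1 / 6)
        \<le> Lp_norm_on 6 ({-1..1} \<times> {-1..1}) (exp_sum N a)"
      by (intro Lp_norm_on_lower_bound continuous_on_exp_sum big compact_Times)
        (simp_all add: B_def K_def)
    have vol: "measure lborel B = r ^ 14 / 25"
      using r unfolding B_def by (simp add: measure_lborel_cbox_eq Basis_prod_def field_simps)
    have "1 / 20 * real N powr (1 / 36) * sqrt K \<le> K / 2 * (r ^ 14 / 25) powr (1 / 6)"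
    proof (rule power_mono_iff[THEN iffD1])
      have "(real N powr (1 / 36)) ^ 6 = s"
        using \<open>N \<ge> 1\<close> by (simp add: s_def root_powr_inverse powr_power)
      moreover have "sqrt K ^ 6 = K ^ 3"
        using power_mult[of "sqrt K" 2 3] by (simp add: K_def)
      ultimately have lhs: "(1 / 20 * real N powr (1 / 36) * sqrt K) ^ 6 = s / 20 ^ 6 * K ^ 3"
        by (simp add: power_mult_distrib power_divide)
      have "((r ^ 14 / 25) powr (1 / 6)) ^ 6 = r ^ 14 / 25"
        using r by (simp add: powr_power)
      then have rhs: "(K / 2 * (r ^ 14 / 25) powr (1 / 6)) ^ 6 = K ^ 6 / 2 ^ 6 * (r ^ 14 / 25)"
        by (simp add: power_mult_distrib power_divide)
      \<comment> \<open>The constant 1600000 is \<open>10 ^ 3 * 2 ^ 6 * 25\<close>, from the length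
        of \<open>I\<close>, the factor 1/2 in \<open>big\<close> and the area of \<open>B\<close>;
        \<open>20 ^ 6\<close> exceeds it.\<close>
      have "s / 20 ^ 6 \<le> s / 1600000"
        using s1 by simp
      also have "\<dots> = s * (s ^ 14 * r ^ 14) / 1600000"
        by (simp add: rsk)
      \<comment> \<open>The gain: \<open>K ^ 3\<close> supplies \<open>s ^ 15\<close> against the
        area factor \<open>r ^ 14\<close>, leaving one \<open>s\<close>, the sixth power of
        \<open>N powr (1 / 36)\<close>.\<close>
      also have "\<dots> = (s ^ 5 / 10) ^ 3 * (r ^ 14 / 1600)"
        by (simp add: power_divide flip: power_mult power_Suc mult.assoc)
      also have "\<dots> \<le> K ^ 3 * (r ^ 14 / 1600)"
        using K_ge s1 r by (intro mult_right_mono power_mono) auto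
      finally have "s / 20 ^ 6 * K ^ 3 \<le> K ^ 3 * (r ^ 14 / 1600) * K ^ 3"
        by (rule mult_right_mono) (simp add: K_def)
      also have "\<dots> = K ^ 6 / 2 ^ 6 * (r ^ 14 / 25)"
        by (simp add: power_add[of K 3 3, simplified] mult_ac)
      finally show "(1 / 20 * real N powr (1 / 36) * sqrt K) ^ 6
          \<le> (K / 2 * (r ^ 14 / 25) powr (1 / 6)) ^ 6"
        unfolding lhs rhs .
    qed (simp_all add: K_def)
    then show "1 / 20 * real N powr (1 / 36) * sqrt (\<Sum>n = - int N..int N. (cmod (a n))\<^sup>2)
        \<le> Lp_norm_on 6 ({-1..1} \<times> {-1..1}) (exp_sum N a)"
      using lower unfolding l2 vol by (rule order_trans)
  qed
qed simp

end
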